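(* Suppose that $r$ is an odd positive integer and let $n=2r$. Let $V$ be a vector space of dimension $n$ over $\mathbb{F}_q$, where $q$ is odd and $q\geq r+1$. Let $\mathcal{M}$ be an $\mathbb{F}_q$-subspace of $\mathrm{Symm}(V)$ of dimension $3r$ in which the rank of any non-zero element is $r$ or $n=2r$. Below, $u,w,z$ denote non-zero elements of $V$. 1. The non-zero elements of each subspace $\mathcal{M}_u$ have the same $r$-dimensional radical. Furthermore, any two of the subspaces $\mathcal{M}_u$ are either identical or intersect trivially. 2. The radicals of the non-zero elements of the subspaces $\mathcal{M}_u$ form a spread of $q^r+1$ $r$-dimensional subspaces that cover $V$. Thus there are $q^r+1$ different subspaces $\mathcal{M}_u$, and any $r$-dimensional constant rank $r$ subspace of $\mathcal{M}$ is of the form $\mathcal{M}_u$. 3. Let $\mathcal{M}_w$ be an $r$-dimensional subspace different from $\mathcal{M}_u$. Then the $n$-dimensional subspace $\mathcal{M}_u\oplus\mathcal{M}_w$ contains no elements of rank $r$ other than the elements of rank $r$ in $\mathcal{M}_u$ and $\mathcal{M}_w$. Thus \[ (\mathcal{M}_u\oplus\mathcal{M}_w)\cap\mathcal{M}_z=0,\qquad \mathcal{M}=\mathcal{M}_u\oplus\mathcal{M}_w\oplus\mathcal{M}_z \] for any $r$-dimensional constant rank $r$ subspace $\mathcal{M}_z$ different from $\mathcal{M}_u$ and $\mathcal{M}_w$.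
   Context: $q$ is a power of a prime and $\mathbb{F}_q$ is the field of order $q$. $\mathrm{Symm}(V)$ denotes the $\mathbb{F}_q$-vector space of all symmetric bilinear forms $f:V\times V\to\mathbb{F}_q$. The radical of $f$ is $\mathrm{rad} f=\{u\in V: f(u,v)=0\text{ for all }v\in V\}$ and $\mathrm{rank} f=\dim V-\dim\mathrm{rad} f$. For $u\in V$, $\mathcal{M}_u=\{f\in\mathcal{M}: u\in\mathrm{rad} f\}$. A constant rank $r$ subspace is a non-zero subspace all of whose non-zero elements have rank $r$. A spread of $V$ by $r$-dimensional subspaces is a set of $r$-dimensional subspaces, pairwise intersecting trivially, whose union is $V$. *)

theory Defs
  imports Complex_Main "HOL-Library.Function_Algebras" "HOL-Library.Set_Algebras"
begin

text \<open>
  The vector space $V$ is the universe of a type \<open>'v\<close>, with scalar multiplication \<open>scale\<close> over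
  the field \<open>'a\<close>. Forms are functions \<open>'v \<Rightarrow> 'v \<Rightarrow> 'a\<close>; their addition and zero are the pointwise
  ones of \<^theory>\<open>HOL-Library.Function_Algebras\<close>, and \<open>A + B\<close> for subspaces \<open>A\<close>, \<open>B\<close> is the
  elementwise sum of \<^theory>\<open>HOL-Library.Set_Algebras\<close>.
\<close>

definition form_scale :: "'a::field \<Rightarrow> ('v \<Rightarrow> 'v \<Rightarrow> 'a) \<Rightarrow> ('v \<Rightarrow> 'v \<Rightarrow> 'a)" where
  "form_scale c f = (\<lambda>u v. c * f u v)"

lemma vector_space_form_scale: "vector_space form_scale"
  by unfold_locales (auto simp: form_scale_def fun_eq_iff algebra_simps)

definition symm_forms ::
    "('a::field \<Rightarrow> 'v::ab_group_add \<Rightarrow> 'v) \<Rightarrow> ('v \<Rightarrow> 'v \<Rightarrow> 'a) set" where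
  "symm_forms scale =
     {f. (\<forall>u. Vector_Spaces.linear scale (*) (\<lambda>v. f u v)) \<and>
         (\<forall>v. Vector_Spaces.linear scale (*) (\<lambda>u. f u v)) \<and>
         (\<forall>u v. f u v = f v u)}"

definition form_rad :: "('v \<Rightarrow> 'v \<Rightarrow> 'a::field) \<Rightarrow> 'v set" where
  "form_rad f = {u. \<forall>v. f u v = 0}"

definition form_rank ::
    "('a::field \<Rightarrow> 'v::ab_group_add \<Rightarrow> 'v) \<Rightarrow> ('v \<Rightarrow> 'v \<Rightarrow> 'a) \<Rightarrow> nat" where
  "form_rank scale f =
     vector_space.dim scale (UNIV :: 'v set) - vector_space.dim scale (form_rad f)"

definition forms_at :: "('v \<Rightarrow> 'v \<Rightarrow> 'a::field) set \<Rightarrow> 'v \<Rightarrow> ('v \<Rightarrow> 'v \<Rightarrow> 'a) set" where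
  "forms_at M u = {f \<in> M. u \<in> form_rad f}"

definition constant_rank_subspace ::
    "('a::field \<Rightarrow> 'v::ab_group_add \<Rightarrow> 'v) \<Rightarrow> nat \<Rightarrow> ('v \<Rightarrow> 'v \<Rightarrow> 'a) set \<Rightarrow> bool" where
  "constant_rank_subspace scale r N \<longleftrightarrow>
     N \<subseteq> symm_forms scale \<and> module.subspace form_scale N \<and> N \<noteq> {0} \<and>
     (\<forall>f\<in>N. f \<noteq> 0 \<longrightarrow> form_rank scale f = r)"

definition is_spread ::
    "('a::field \<Rightarrow> 'v::ab_group_add \<Rightarrow> 'v) \<Rightarrow> nat \<Rightarrow> 'v set set \<Rightarrow> bool" where
  "is_spread scale r S \<longleftrightarrow>
     (\<forall>U\<in>S. module.subspace scale U \<and> vector_space.dim scale U = r) \<and>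
     (\<forall>U\<in>S. \<forall>W\<in>S. U \<noteq> W \<longrightarrow> U \<inter> W = {0}) \<and>
     \<Union>S = UNIV"

end

theory Submission
  imports Defs "HOL-Number_Theory.Residues" "HOL-Library.Cardinality"
begin

text \<open>
  Everything rests on the constant rank \<open>r\<close> subspaces \<open>N\<close> of \<open>M\<close>, and there two estimates pull in
  opposite directions. Write \<open>Z\<close> for the set of vectors \<open>u\<close> with \<open>f u u = 0\<close> for every \<open>f\<close> in \<open>N\<close>.

  \<^item> A symmetric form of odd rank on \<open>n\<close>-space has exactly \<open>q\<^sup>n / q\<close> isotropic vectors
    (\<open>card_isotropic_odd_rank\<close>), just as if its values were equidistributed. Counting the pairs
    \<open>(f, u)\<close> with \<open>f u u = 0\<close> in two ways then gives \<open>card Z * card N = q\<^sup>n\<close>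
    (\<open>card_common_isotropic\<close>).
  \<^item> Since \<open>r < q\<close>, every form of \<open>N\<close> vanishes on the radical of every other one
    (\<open>pencil_isotropic_on_radical\<close>). So \<open>Z\<close> contains all the radicals, each of size
    \<open>q\<^sup>n / q\<^sup>r\<close>.

  Together these give \<open>card N \<le> q\<^sup>r\<close>, and equality forces every radical to be equal to \<open>Z\<close>
  (\<open>large_constant_rank_subspace\<close>).

  Now \<open>forms_at M u\<close> is the kernel of the linear map \<open>f \<mapsto> f u\<close> from \<open>M\<close> to the dual space, so its
  dimension is at least \<open>3 r - 2 r = r\<close>, and for \<open>u \<noteq> 0\<close> its non-zero elements have rank \<open>r\<close>. Hence
  equality holds: each \<open>forms_at M u\<close> has dimension \<open>r\<close> and a single common radical, which contains
  \<open>u\<close>. Two such radicals with a common non-zero vector \<open>x\<close> both belong to \<open>forms_at M x\<close>, so they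
  are equal; this gives the spread and its cardinality. Finally, if two of the spaces \<open>forms_at M u\<close>,
  \<open>forms_at M w\<close> differ, then \<open>V\<close> is the direct sum of their radicals, and a sum of non-zero forms
  from the two spaces is an orthogonal sum of two nondegenerate forms of rank \<open>r\<close>, hence
  nondegenerate. This is the statement about the elements of rank \<open>r\<close>, and the decomposition of
  \<open>M\<close> follows by counting.

  Over a finite field a subspace of dimension \<open>m\<close> is one with \<open>q\<^sup>m\<close> elements, and all dimension
  arguments are carried out as counting arguments.
\<close>

section \<open>Values of binary quadratic forms over a finite field\<close>

text \<open>The characteristic divides the order of the field, so it cannot be 2.\<close>

lemma odd_card_imp_two_neq_zero:
  assumes "odd (card (UNIV :: 'a::{field,finite} set))"
  shows "(2::'a) \<noteq> 0"
proof
  assume "(2::'a) = 0"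
  then have "of_nat 2 = (0::'a)" by simp
  then have "CHAR('a) dvd 2" by (simp only: of_nat_eq_0_iff_char_dvd)
  moreover have "CHAR('a) \<noteq> Suc 0" by simp
  ultimately have "CHAR('a) = 2"
    using prime_nat_iff two_is_prime_nat by auto
  with CHAR_dvd_CARD[where 'a = 'a] assms show False by simp
qed

text \<open>Squaring is at most two-to-one, and one-to-one over 0; that last point is the source of the
  summand 1, which the pigeonhole argument below needs.\<close>

lemma card_squares_finite_field:
  "card (UNIV :: 'a::{field,finite} set) + 1 \<le> 2 * card (range (\<lambda>x::'a. x\<^sup>2))"
proof -
  let ?Q = "range (\<lambda>x::'a. x\<^sup>2)"
  have fib: "card {x. x\<^sup>2 = y} \<le> (if y = 0 then 1 else 2)" for y :: 'a
  proof (cases "\<exists>z. z\<^sup>2 = y")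
    case True
    then obtain z where z: "z\<^sup>2 = y" by blast
    then have "{x. x\<^sup>2 = y} \<subseteq> {z, -z}" by (auto simp: power2_eq_iff)
    then have "card {x. x\<^sup>2 = y} \<le> card {z, -z}" by (intro card_mono) auto
    also have "\<dots> \<le> (if y = 0 then 1 else 2)" using z by (auto simp: card_insert_if)
    finally show ?thesis .
  qed auto
  have "card (UNIV :: 'a set) = (\<Sum>y\<in>?Q. card {x. x\<^sup>2 = y})"
    using sum.group[of "UNIV :: 'a set" ?Q "\<lambda>x. x\<^sup>2" "\<lambda>_. 1::nat"] by simp
  also have "\<dots> \<le> (\<Sum>y\<in>?Q. if y = 0 then 1 else 2)"
    by (intro sum_mono fib)
  also have "\<dots> = (\<Sum>y\<in>insert 0 (?Q - {0}). if y = 0 then 1 else 2)"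
    by (intro sum.cong) (auto intro: range_eqI[of _ _ 0])
  also have "\<dots> = 1 + 2 * (card ?Q - 1)"
    by (subst sum.insert) (auto simp: card_Diff_singleton_if image_iff intro: exI[of _ 0])
  finally have "card (UNIV :: 'a set) \<le> 1 + 2 * (card ?Q - 1)" .
  moreover have "card ?Q \<ge> 1" by (simp add: Suc_le_eq card_gt_0_iff)
  ultimately show ?thesis by linarith
qed

text \<open>The sets of values of \<open>x\<^sup>2\<close> and of \<open>a - k * y\<^sup>2\<close> each contain more than half of the field, so
  they meet.\<close>

lemma binary_form_represents:
  fixes k a :: "'a::{field,finite}"
  assumes "k \<noteq> 0"
  shows "\<exists>x y. x\<^sup>2 + k * y\<^sup>2 = a"
proof -
  let ?Q = "range (\<lambda>x::'a. x\<^sup>2)" and ?R = "(\<lambda>s. a - k * s) ` range (\<lambda>x::'a. x\<^sup>2)"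
  have "inj_on (\<lambda>s. a - k * s) ?Q" using assms by (auto intro!: inj_onI)
  then have "card ?R = card ?Q" by (rule card_image)
  then have "card (UNIV :: 'a set) < card ?Q + card ?R"
    using card_squares_finite_field[where 'a = 'a] by linarith
  moreover have "card (?Q \<union> ?R) \<le> card (UNIV :: 'a set)" by (intro card_mono) auto
  ultimately have "?Q \<inter> ?R \<noteq> {}"
    using card_Un_disjoint[of ?Q ?R] by fastforce
  then obtain x y where "x\<^sup>2 = a - k * y\<^sup>2" by auto
  then show ?thesis by (intro exI[of _ x] exI[of _ y]) (simp add: algebra_simps)
qed

text \<open>
  Up to the factor \<open>d\<close> the form is the norm form \<open>x\<^sup>2 + k * y\<^sup>2\<close>, which is multiplicative. Multiplying
  by a pair of norm \<open>s \<noteq> 0\<close> embeds the solutions for \<open>c\<close> into those for \<open>s * c\<close>, and such a pair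
  exists for every \<open>s\<close>.
\<close>

lemma binary_form_equidistributed:
  fixes d e a b :: "'a::{field,finite}"
  assumes "d \<noteq> 0" "e \<noteq> 0" "a \<noteq> 0" "b \<noteq> 0"
  shows "card {(x, y). d * x\<^sup>2 + e * y\<^sup>2 = a} = card {(x, y). d * x\<^sup>2 + e * y\<^sup>2 = b}"
proof -
  define k where "k = e / d"
  have k: "k \<noteq> 0" using assms by (simp add: k_def)
  let ?N = "\<lambda>c. {(x, y). x\<^sup>2 + k * y\<^sup>2 = c}"
  have norm: "{(x, y). d * x\<^sup>2 + e * y\<^sup>2 = c} = ?N (c / d)" for c
    using \<open>d \<noteq> 0\<close> by (auto simp: k_def field_simps)
  have le: "card (?N c) \<le> card (?N (s * c))" if "s \<noteq> 0" for s c
  proof -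
    obtain x0 y0 where s: "x0\<^sup>2 + k * y0\<^sup>2 = s" using binary_form_represents[OF k] by blast
    \<comment> \<open>multiplication by \<open>x0 + y0 * sqrt (- k)\<close>\<close>
    let ?h = "\<lambda>(x, y). (x0 * x - k * y0 * y, x0 * y + y0 * x)"
    have "inj ?h"
    proof (rule injI, clarify)
      fix x y x' y'
      assume h1: "x0 * x - k * y0 * y = x0 * x' - k * y0 * y'"
        and h2: "x0 * y + y0 * x = x0 * y' + y0 * x'"
      have "s * x = x0 * (x0 * x - k * y0 * y) + k * y0 * (x0 * y + y0 * x)"
        unfolding s[symmetric] by (simp add: algebra_simps power2_eq_square)
      also have "\<dots> = s * x'"
        unfolding h1 h2 s[symmetric] by (simp add: algebra_simps power2_eq_square)
      finally have "x = x'" using that by simp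
      have "s * y = x0 * (x0 * y + y0 * x) - y0 * (x0 * x - k * y0 * y)"
        unfolding s[symmetric] by (simp add: algebra_simps power2_eq_square)
      also have "\<dots> = s * y'"
        unfolding h1 h2 s[symmetric] by (simp add: algebra_simps power2_eq_square)
      finally have "y = y'" using that by simp
      with \<open>x = x'\<close> show "x = x' \<and> y = y'" by simp
    qed
    moreover have "?h ` ?N c \<subseteq> ?N (s * c)"
      unfolding s[symmetric] by (auto simp: algebra_simps power2_eq_square)
    ultimately show ?thesis
      by (intro card_inj_on_le[of ?h]) (auto intro: inj_on_subset)
  qed
  have "card (?N (a / d)) = card (?N (b / d))"
    using le[of "b / a" "a / d"] le[of "a / b" "b / d"] assms by (intro antisym) simp_all
  then show ?thesis by (simp only: norm)
qed

text \<open>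
  If \<open>F\<close> takes its mean value at 0, so does its convolution with the distribution of values of a
  binary form: that distribution is constant away from 0, so convolving with it is the sum of an
  averaging and a multiple of the identity. This is the step from rank \<open>m\<close> to rank \<open>m + 2\<close> in the
  count of isotropic vectors.
\<close>

lemma sum_over_binary_form:
  fixes d e :: "'a::{field,finite}" and F :: "'a \<Rightarrow> nat"
  defines "q \<equiv> card (UNIV :: 'a set)"
  assumes "d \<noteq> 0" "e \<noteq> 0" "(\<Sum>a\<in>UNIV. F a) = q * F 0"
  shows "(\<Sum>x\<in>UNIV. \<Sum>y\<in>UNIV. F (d * x\<^sup>2 + e * y\<^sup>2)) = q\<^sup>2 * F 0"
proof -
  let ?B = "\<lambda>a. {(x, y). d * x\<^sup>2 + e * y\<^sup>2 = a}"
  define k where "k = card (?B 1)"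
  have q: "q \<ge> 1" by (simp add: q_def Suc_le_eq card_gt_0_iff)
  have B: "card (?B a) = k" if "a \<noteq> 0" for a
    unfolding k_def using binary_form_equidistributed[of d e a 1] assms that by simp
  have weighted: "(\<Sum>x\<in>UNIV. \<Sum>y\<in>UNIV. G (d * x\<^sup>2 + e * y\<^sup>2)) + k * G 0
      = card (?B 0) * G 0 + k * (\<Sum>a\<in>UNIV. G a)" for G :: "'a \<Rightarrow> nat"
  proof -
    have "(\<Sum>x\<in>UNIV. \<Sum>y\<in>UNIV. G (d * x\<^sup>2 + e * y\<^sup>2))
        = (\<Sum>p\<in>UNIV. G (d * (fst p)\<^sup>2 + e * (snd p)\<^sup>2))"
      by (simp add: sum.cartesian_product case_prod_beta)
    also have "\<dots> = (\<Sum>a\<in>UNIV. \<Sum>p\<in>{p \<in> UNIV. d * (fst p)\<^sup>2 + e * (snd p)\<^sup>2 = a}.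
        G (d * (fst p)\<^sup>2 + e * (snd p)\<^sup>2))"
      by (rule sum.group[symmetric]) auto
    also have "\<dots> = (\<Sum>a\<in>UNIV. card (?B a) * G a)"
      by (simp add: case_prod_unfold)
    also have "\<dots> = card (?B 0) * G 0 + (\<Sum>a\<in>UNIV-{0}. k * G a)"
      by (subst sum.remove[of _ 0]) (auto simp: B intro!: sum.cong)
    finally show ?thesis
      by (subst (2) sum.remove[of _ 0]) (auto simp: sum_distrib_left algebra_simps)
  qed
  \<comment> \<open>the total number of pairs is obtained from the weight 1\<close>
  have "q * q + k = card (?B 0) + k * q"
    using weighted[of "\<lambda>_. 1"] by (simp add: q_def)
  then have "(card (?B 0) + k * q) * F 0 = (q\<^sup>2 + k) * F 0" by (simp add: power2_eq_square)
  with weighted[of F] assms(4) show ?thesis by (simp add: algebra_simps)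
qed

section \<open>Finite vector spaces\<close>

lemma (in vector_space) finite_span:
  assumes "finite (UNIV :: 'a set)" "finite B"
  shows "finite (span B)"
  using assms(2)
proof (induction B rule: finite_induct)
  case (insert b B)
  have "span (insert b B) \<subseteq> (\<lambda>(t, w). scale t b + w) ` (UNIV \<times> span B)"
  proof
    fix x assume "x \<in> span (insert b B)"
    then obtain t where "x - scale t b \<in> span B" by (auto simp: span_insert)
    then show "x \<in> (\<lambda>(t, w). scale t b + w) ` (UNIV \<times> span B)"
      by (intro image_eqI[of _ _ "(t, x - scale t b)"]) auto
  qed
  then show ?case using insert assms(1) by (auto intro: finite_subset)
qed simp

locale finite_vector_space = vector_space scale
  for scale :: "'a::{field,finite} \<Rightarrow> 'v::ab_group_add \<Rightarrow> 'v" (infixr \<open>*s\<close> 75) +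
  assumes finite_space: "finite (UNIV :: 'v set)"
begin

lemma card_field_ge_2: "CARD('a) \<ge> 2"
proof -
  have "card {0, 1 :: 'a} \<le> CARD('a)" by (intro card_mono) auto
  then show ?thesis by simp
qed

lemma finite_vectors [simp]: "finite (S :: 'v set)"
  by (rule finite_subset[OF subset_UNIV finite_space])

lemma card_subspace_pos: "subspace S \<Longrightarrow> card S > 0"
  by (auto simp: card_gt_0_iff dest: subspace_0)

lemma subspace_set_plus: "subspace A \<Longrightarrow> subspace B \<Longrightarrow> subspace (A + B)"
proof -
  have "A + B = {x + y |x y. x \<in> A \<and> y \<in> B}" by (auto simp: set_plus_def)
  then show "subspace A \<Longrightarrow> subspace B \<Longrightarrow> subspace (A + B)"
    using subspace_sums[of A B] by simp
qed

lemma card_set_plus: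
  assumes "subspace A" "subspace B" "A \<inter> B = {0}"
  shows "card (A + B) = card A * card B"
proof -
  have "inj_on (\<lambda>(a, b). a + b) (A \<times> B)"
  proof (rule inj_onI, clarify)
    fix a b a' b'
    assume *: "a \<in> A" "b \<in> B" "a' \<in> A" "b' \<in> B" "a + b = a' + b'"
    then have "a - a' = b' - b" by (simp add: algebra_simps)
    moreover have "a - a' \<in> A" "b' - b \<in> B" using * assms by (auto intro: subspace_diff)
    ultimately have "a - a' \<in> A \<inter> B" "b' - b \<in> A \<inter> B" by auto
    then have "a - a' = 0" "b' - b = 0" using assms(3) by blast+
    then show "a = a' \<and> b = b'" by simp
  qed
  moreover have "A + B = (\<lambda>(a, b). a + b) ` (A \<times> B)" by (auto simp: set_plus_def)
  ultimately show ?thesis by (simp add: card_image card_cartesian_product)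
qed

lemma subspaces_meet_of_card:
  assumes "subspace A" "subspace B" "card A * card B > card (UNIV :: 'v set)"
  shows "\<exists>x. x \<noteq> 0 \<and> x \<in> A \<and> x \<in> B"
proof (rule ccontr)
  assume "\<not> ?thesis"
  with assms(1,2) have "A \<inter> B = {0}" by (auto simp: subspace_0)
  with assms(1,2) have "card (A + B) = card A * card B" by (rule card_set_plus)
  moreover have "card (A + B) \<le> card (UNIV :: 'v set)" by (intro card_mono) auto
  ultimately show False using assms(3) by simp
qed

lemma span_line: "span {v} = range (\<lambda>t. t *s v)"
  by (rule span_singleton)

lemma card_line: "v \<noteq> 0 \<Longrightarrow> card (span {v}) = CARD('a)"
  unfolding span_line by (intro card_image injI) simp

lemma card_span_independent:
  assumes "independent B"
  shows "card (span B) = CARD('a) ^ card B"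
  using finite_vectors[of B] assms
proof (induction B rule: finite_induct)
  case (insert b B)
  have b: "b \<notin> span B" "independent B"
    using insert by (auto simp: independent_insert split: if_splits)
  have "span (insert b B) = span {b} + span B"
    using span_Un[of "{b}" B] by (auto simp: set_plus_def)
  moreover have "span {b} \<inter> span B = {0}"
  proof -
    have "t *s b = 0" if "t *s b \<in> span B" for t
    proof (rule ccontr)
      assume "t *s b \<noteq> 0"
      then have "t \<noteq> 0" by auto
      then show False using span_scale[OF that, of "inverse t"] b by simp
    qed
    then have "span {b} \<inter> span B \<subseteq> {0}" by (auto simp: span_line)
    then show ?thesis using span_zero by blast
  qed
  moreover have "b \<noteq> 0" using b span_zero by auto
  ultimately show ?case
    using insert b by (simp add: card_set_plus card_line)
qed simp

lemma card_subspace: "subspace S \<Longrightarrow> card S = CARD('a) ^ dim S"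
  by (metis basis_exists card_span_independent span_subspace)

lemma dim_eq_iff_card: "subspace S \<Longrightarrow> dim S = m \<longleftrightarrow> card S = CARD('a) ^ m"
  using card_field_ge_2 by (simp add: card_subspace)

text \<open>A subspace of \<open>H\<close> that is maximal among those meeting \<open>R\<close> trivially must, together with \<open>R\<close>,
  span \<open>H\<close>: otherwise a vector outside the sum could be adjoined.\<close>

lemma complement_within:
  assumes R: "subspace R" and H: "subspace H"
  obtains C where "subspace C" "C \<subseteq> H" "C \<inter> R = {0}" "H \<subseteq> C + R"
proof -
  let ?P = "\<lambda>C. subspace C \<and> C \<subseteq> H \<and> C \<inter> R = {0}"
  have "?P {0}" using R H by (auto simp: subspace_0)
  moreover have "finite {C. ?P C}"
    by (rule finite_subset[of _ "Pow UNIV"]) (simp_all only: finite_Pow_iff finite_space, auto)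
  ultimately have "\<exists>C\<in>{C. ?P C}. \<forall>D\<in>{C. ?P C}. C \<subseteq> D \<longrightarrow> C = D"
    by (intro finite_has_maximal) blast+
  then obtain C where C: "subspace C" "C \<subseteq> H" "C \<inter> R = {0}"
    and max: "\<And>D. subspace D \<Longrightarrow> D \<subseteq> H \<Longrightarrow> D \<inter> R = {0} \<Longrightarrow> C \<subseteq> D \<Longrightarrow> C = D"
    by auto
  have "h \<in> C + R" if h: "h \<in> H" for h
  proof (rule ccontr)
    assume not: "h \<notin> C + R"
    let ?D = "C + span {h}"
    have "subspace ?D" using C by (intro subspace_set_plus) auto
    moreover have "?D \<subseteq> H"
    proof
      fix x assume "x \<in> ?D"
      then obtain c t where "x = c + t *s h" "c \<in> C" by (auto simp: set_plus_def span_line)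
      then show "x \<in> H" using C(2) h H by (auto intro!: subspace_add subspace_scale)
    qed
    moreover have "?D \<inter> R = {0}"
    proof -
      have "c + t *s h = 0" if "c \<in> C" and "c + t *s h \<in> R" for c t
      proof (cases "t = 0")
        case True
        then show ?thesis using C(3) that by auto
      next
        case False
        have "h = inverse t *s (- c) + inverse t *s (c + t *s h)"
          using False by (simp add: algebra_simps)
        moreover have "inverse t *s (- c) \<in> C"
          using C(1) that(1) by (intro subspace_scale subspace_neg)
        moreover have "inverse t *s (c + t *s h) \<in> R"
          using R that(2) by (rule subspace_scale)
        ultimately show ?thesis using not by (metis set_plus_intro)
      qed
      then have "?D \<inter> R \<subseteq> {0}" by (auto simp: set_plus_def span_line)
      then show ?thesis using subspace_0[OF \<open>subspace ?D\<close>] subspace_0[OF R] by blast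
    qed
    moreover have "C \<subseteq> ?D" using set_plus_intro[OF _ span_zero] by fastforce
    ultimately have "C = ?D" by (rule max)
    moreover have "h \<in> ?D"
      using set_plus_intro[OF subspace_0[OF C(1)] span_base[of h "{h}"]] by simp
    ultimately have "h \<in> C" by simp
    then show False using not set_plus_intro[of h C 0 R] subspace_0[OF R] by simp
  qed
  then have "H \<subseteq> C + R" by (rule subsetI)
  then show ?thesis by (rule that[OF C])
qed

text \<open>The rank-nullity theorem in multiplicative form; additivity suffices, because all non-empty
  fibres are cosets of the kernel.\<close>

lemma card_kernel:
  fixes \<phi> :: "'v \<Rightarrow> 'b::ab_group_add"
  assumes S: "subspace S"
    and add: "\<And>x y. x \<in> S \<Longrightarrow> y \<in> S \<Longrightarrow> \<phi> (x + y) = \<phi> x + \<phi> y"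
  shows "card S = card (\<phi> ` S) * card {x \<in> S. \<phi> x = 0}"
proof -
  have zero: "\<phi> 0 = 0" using add[of 0 0] S by (simp add: subspace_0)
  have "card {x \<in> S. \<phi> x = \<phi> s} = card {x \<in> S. \<phi> x = 0}" if s: "s \<in> S" for s
  proof -
    have "\<phi> (x - s) = \<phi> x - \<phi> s" if "x \<in> S" for x
      using add[of "x - s" s] that s S by (simp add: subspace_diff)
    then have "bij_betw (\<lambda>x. x - s) {x \<in> S. \<phi> x = \<phi> s} {x \<in> S. \<phi> x = 0}"
      using s S add by (intro bij_betw_byWitness[where f' = "\<lambda>x. x + s"])
        (auto simp: subspace_diff subspace_add)
    then show ?thesis by (rule bij_betw_same_card)
  qed
  moreover have "card S = (\<Sum>y\<in>\<phi> ` S. card {x \<in> S. \<phi> x = y})"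
    using sum.group[of S "\<phi> ` S" \<phi> "\<lambda>_. 1::nat"] by simp
  moreover have "\<dots> = (\<Sum>y\<in>\<phi> ` S. card {x \<in> S. \<phi> x = 0})"
    using calculation by (intro sum.cong) auto
  ultimately show ?thesis by simp
qed

lemma card_linear_functionals:
  "card {\<phi>. Vector_Spaces.linear scale (*) \<phi>} \<le> CARD('a) ^ dim UNIV"
proof -
  interpret functionals: vector_space_pair scale "(*) :: 'a \<Rightarrow> 'a \<Rightarrow> 'a"
    by unfold_locales (auto simp: algebra_simps)
  obtain B where B: "independent B" "UNIV \<subseteq> span B" "card B = dim UNIV"
    using basis_exists by metis
  let ?L = "{\<phi>. Vector_Spaces.linear scale (*) \<phi>}"
  have "inj_on (\<lambda>\<phi>. restrict \<phi> B) ?L"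
  proof (rule inj_onI)
    fix \<phi> \<psi> assume *: "\<phi> \<in> ?L" "\<psi> \<in> ?L" "restrict \<phi> B = restrict \<psi> B"
    have "\<phi> x = \<psi> x" for x
    proof (rule functionals.linear_eq_on)
      show "x \<in> span B" using B by auto
      show "\<phi> b = \<psi> b" if "b \<in> B" for b using * that by (metis restrict_apply')
    qed (use * in auto)
    then show "\<phi> = \<psi>" by auto
  qed
  then have "card ?L \<le> card (B \<rightarrow>\<^sub>E (UNIV :: 'a set))"
    by (rule card_inj_on_le) (auto intro!: finite_PiE)
  then show ?thesis by (simp add: card_funcsetE B)
qed

end

section \<open>Isotropic vectors of symmetric bilinear forms\<close>

context finite_vector_space
begin

context
  fixes f :: "'v \<Rightarrow> 'v \<Rightarrow> 'a"
  assumes f: "f \<in> symm_forms scale"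
begin

lemma form_add_right: "f u (v + w) = f u v + f u w"
  and form_scale_right: "f u (c *s v) = c * f u v"
  and form_add_left: "f (v + w) u = f v u + f w u"
  and form_scale_left: "f (c *s v) u = c * f v u"
  using f by (simp_all add: symm_forms_def Vector_Spaces.linear_iff)

lemma form_sym: "f u v = f v u"
  using f by (auto simp: symm_forms_def)

lemma form_zero_right: "f u 0 = 0" and form_zero_left: "f 0 u = 0"
  using form_scale_right[of u 0 0] form_scale_left[of 0 0 u] by simp_all

lemma form_diff_right: "f u (v - w) = f u v - f u w"
  using form_add_right[of u "v - w" w] by simp

lemma form_diff_left: "f (v - w) u = f v u - f w u"
  using form_add_left[of "v - w" w u] by simp

lemmas form_simps = form_add_right form_add_left form_scale_right form_scale_left
  form_zero_right form_zero_left form_diff_right form_diff_left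

lemma form_sum_left: "f (sum g A) u = (\<Sum>a\<in>A. f (g a) u)"
  by (induction A rule: infinite_finite_induct) (auto simp: form_simps)

lemma subspace_form_rad: "subspace (form_rad f)"
  by (auto simp: subspace_def form_rad_def form_simps)

lemma subspace_orthogonal: "subspace {v. f u v = 0}"
  by (auto simp: subspace_def form_simps)

text \<open>Polarization.\<close>

lemma exists_anisotropic:
  assumes "(2::'a) \<noteq> 0" "subspace S" "x \<in> S" "y \<in> S" "f x y \<noteq> 0"
  shows "\<exists>v\<in>S. f v v \<noteq> 0"
proof (rule ccontr)
  assume *: "\<not> ?thesis"
  then have "f (x + y) (x + y) = 0" "f x x = 0" "f y y = 0"
    using assms subspace_add by blast+
  then have "2 * f x y = 0" using form_sym[of y x] by (simp add: form_simps)
  with assms show False by simp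
qed

text \<open>Splitting off an anisotropic line leaves the radical unchanged and lowers the dimension by one,
  hence also the rank.\<close>

lemma split_anisotropic:
  assumes S: "subspace S" and v: "v \<in> S" "f v v \<noteq> 0"
  defines "T \<equiv> {w \<in> S. f v w = 0}"
  shows "subspace T"
    and "card S = CARD('a) * card T"
    and "{x \<in> S. \<forall>y\<in>S. f x y = 0} = {x \<in> T. \<forall>y\<in>T. f x y = 0}"
    and "card {x \<in> S. f x x = c} = (\<Sum>t\<in>UNIV. card {w \<in> T. f w w = c - f v v * t\<^sup>2})"
proof -
  show T: "subspace T" using S by (auto simp: subspace_def T_def form_simps)
  let ?h = "\<lambda>(t, w). t *s v + w"
  have inj: "inj_on ?h (UNIV \<times> T)"
  proof (rule inj_onI, clarify)
    fix t w t' w' assume *: "w \<in> T" "w' \<in> T" "t *s v + w = t' *s v + w'"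
    have "f v (t *s v + w) = f v (t' *s v + w')" by (simp only: *(3))
    with *(1,2) v have "t = t'" by (simp add: T_def form_simps)
    with * show "t = t' \<and> w = w'" by simp
  qed
  have dec: "x - (f v x / f v v) *s v \<in> T" if "x \<in> S" for x
    using that S v by (auto simp: T_def subspace_diff subspace_scale form_simps)
  have sub: "t *s v + w \<in> S" if "w \<in> T" for t w
    using that S v by (auto simp: T_def subspace_add subspace_scale)
  have img: "S = ?h ` (UNIV \<times> T)"
  proof (intro equalityI subsetI)
    fix x assume "x \<in> S"
    then show "x \<in> ?h ` (UNIV \<times> T)"
      using dec by (intro image_eqI[of _ _ "(f v x / f v v, x - (f v x / f v v) *s v)"]) auto
  qed (use sub in auto)
  show "card S = CARD('a) * card T"
    by (subst img) (simp add: card_image[OF inj] card_cartesian_product)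
  have val: "f (t *s v + w) (t *s v + w) = f v v * t\<^sup>2 + f w w" if "w \<in> T" for t w
    using that form_sym[of w v] by (simp add: T_def power2_eq_square algebra_simps form_simps)
  have "{x \<in> S. f x x = c} = ?h ` (SIGMA t : UNIV. {w \<in> T. f w w = c - f v v * t\<^sup>2})"
    (is "_ = ?h ` ?A")
  proof (intro equalityI subsetI)
    fix x assume x: "x \<in> {x \<in> S. f x x = c}"
    let ?w = "x - (f v x / f v v) *s v"
    have "f v v * (f v x / f v v)\<^sup>2 + f ?w ?w = c"
      using val[of ?w "f v x / f v v"] dec[of x] x by simp
    then show "x \<in> ?h ` ?A" using dec[of x] x
      by (intro image_eqI[of _ _ "(f v x / f v v, ?w)"]) (auto simp: algebra_simps)
  next
    fix x assume "x \<in> ?h ` ?A"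
    then show "x \<in> {x \<in> S. f x x = c}" using val sub by auto
  qed
  then have "card {x \<in> S. f x x = c} = card ?A"
    using inj by (simp add: card_image inj_on_subset[OF inj] Sigma_mono)
  then show "card {x \<in> S. f x x = c} = (\<Sum>t\<in>UNIV. card {w \<in> T. f w w = c - f v v * t\<^sup>2})"
    by simp
  show "{x \<in> S. \<forall>y\<in>S. f x y = 0} = {x \<in> T. \<forall>y\<in>T. f x y = 0}"
  proof (intro equalityI subsetI)
    fix x assume "x \<in> {x \<in> S. \<forall>y\<in>S. f x y = 0}"
    then show "x \<in> {x \<in> T. \<forall>y\<in>T. f x y = 0}" using v form_sym[of v x] by (auto simp: T_def)
  next
    fix x assume x: "x \<in> {x \<in> T. \<forall>y\<in>T. f x y = 0}"
    then have "f x (t *s v + w) = 0" if "w \<in> T" for t w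
      using that form_sym[of x v] by (simp add: T_def form_simps)
    then have "f x y = 0" if "y \<in> S" for y
      using dec[OF that] by (metis add.commute diff_add_cancel)
    with x show "x \<in> {x \<in> S. \<forall>y\<in>S. f x y = 0}" by (auto simp: T_def)
  qed
qed

text \<open>
  The restriction of \<open>f\<close> to \<open>S\<close> has rank \<open>m - k\<close>, and the parity condition says that it is odd.
  Two anisotropic vectors are split off at a time, which keeps the rank odd, and
  \<open>sum_over_binary_form\<close> transports the count from the remaining subspace. The induction ends at
  rank 1, where the form is \<open>d * t\<^sup>2\<close> plus a totally isotropic subspace of codimension 1. The count is
  stated as a product to avoid the exponent \<open>m - 1\<close>.
\<close>

lemma card_isotropic_odd_rank:
  assumes two: "(2::'a) \<noteq> 0"
  shows "subspace S \<Longrightarrow> card S = CARD('a) ^ m \<Longrightarrow>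
    card {x \<in> S. \<forall>y\<in>S. f x y = 0} = CARD('a) ^ k \<Longrightarrow> even m \<noteq> even k \<Longrightarrow>
    CARD('a) * card {x \<in> S. f x x = 0} = CARD('a) ^ m"
proof (induction m arbitrary: S rule: less_induct)
  case (less m)
  let ?q = "CARD('a)"
  note q = card_field_ge_2
  \<comment> \<open>a totally isotropic subspace is its own radical, so it has rank 0\<close>
  have not_isotropic: "\<exists>v\<in>S'. f v v \<noteq> 0"
    if S': "subspace S'" "card S' = ?q ^ l" "card {x \<in> S'. \<forall>y\<in>S'. f x y = 0} = ?q ^ k" "even l \<noteq> even k" for S' l
  proof (rule ccontr)
    assume "\<not> ?thesis"
    then have "{x \<in> S'. \<forall>y\<in>S'. f x y = 0} = S'" using exists_anisotropic[OF two S'(1)] by blast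
    with S' q show False by simp
  qed
  obtain v where v: "v \<in> S" "f v v \<noteq> 0" using not_isotropic less.prems by blast
  define T where "T = {w \<in> S. f v w = 0}"
  note split = split_anisotropic[OF less.prems(1) v, folded T_def]
  have "m \<noteq> 0"
  proof
    assume "m = 0"
    with split(2) less.prems(2) q show False by simp
  qed
  then obtain m1 where m1: "m = Suc m1" by (cases m) auto
  have cardT: "card T = ?q ^ m1" using split(2) less.prems(2) m1 q by simp
  show ?case
  proof (cases "\<exists>w\<in>T. f w w \<noteq> 0")
    case False
    have "card {w \<in> T. f w w = 0 - f v v * t\<^sup>2} = (if t = 0 then card T else 0)" for t
      using False v by (auto intro: arg_cong[where f = card])
    then have "card {x \<in> S. f x x = 0} = card T" by (simp add: split(4))
    then show ?thesis by (simp add: cardT m1)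
  next
    case True
    then obtain v' where v': "v' \<in> T" "f v' v' \<noteq> 0" by blast
    define T' where "T' = {w \<in> T. f v' w = 0}"
    note split' = split_anisotropic[OF split(1) v', folded T'_def]
    have "m1 \<noteq> 0"
    proof
      assume "m1 = 0"
      with split'(2) cardT q show False by simp
    qed
    then obtain m2 where m2: "m1 = Suc m2" by (cases m1) auto
    have cardT': "card T' = ?q ^ m2" using split'(2) cardT m2 q by simp
    \<comment> \<open>the sign turns an isotropic sum into an argument of \<open>F\<close> that is a value of the binary form\<close>
    define F where "F a = card {w \<in> T'. f w w = - a}" for a
    have IH: "?q * F 0 = ?q ^ m2"
      unfolding F_def using less.IH[of m2 T'] split'(1,3) split(3) cardT' less.prems m1 m2 by simp
    have "(\<Sum>a\<in>UNIV. F a) = (\<Sum>a\<in>UNIV. card {w \<in> T'. - f w w = a})"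
      unfolding F_def by (intro sum.cong refl arg_cong[where f = card]) auto
    also have "\<dots> = card T'"
      using sum.group[of T' UNIV "\<lambda>w. - f w w" "\<lambda>_. 1::nat"] by simp
    finally have "(\<Sum>x\<in>UNIV. \<Sum>y\<in>UNIV. F (f v v * x\<^sup>2 + f v' v' * y\<^sup>2)) = ?q\<^sup>2 * F 0"
      using v v' IH cardT' by (intro sum_over_binary_form) auto
    moreover have "card {x \<in> S. f x x = 0} = (\<Sum>x\<in>UNIV. \<Sum>y\<in>UNIV. F (f v v * x\<^sup>2 + f v' v' * y\<^sup>2))"
      unfolding F_def by (simp add: split(4) split'(4))
    ultimately show ?thesis using IH by (simp add: m1 m2 power2_eq_square)
  qed
qed

end

end

section \<open>Constant rank subspaces\<close>

locale finite_form_space = finite_vector_space scale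
  for scale :: "'a::{field,finite} \<Rightarrow> 'v::ab_group_add \<Rightarrow> 'v" (infixr \<open>*s\<close> 75)
begin

lemma finite_maps: "finite (UNIV :: 'b set) \<Longrightarrow> finite (UNIV :: ('v \<Rightarrow> 'b) set)"
  using finite_space by (simp add: finite_UNIV_fun)

sublocale form: finite_vector_space "form_scale :: 'a \<Rightarrow> ('v \<Rightarrow> 'v \<Rightarrow> 'a) \<Rightarrow> _"
  by (intro finite_vector_space.intro finite_vector_space_axioms.intro vector_space_form_scale
      finite_maps finite)

lemma subspace_symm_forms: "form.subspace (symm_forms scale)"
proof (rule form.subspaceI)
  have "vector_space ((*) :: 'a \<Rightarrow> _)" by unfold_locales (simp_all add: algebra_simps)
  then show "0 \<in> symm_forms scale"
    using vector_space_axioms by (simp add: symm_forms_def Vector_Spaces.linear_iff)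
next
  fix f g assume "f \<in> symm_forms scale" "g \<in> symm_forms scale"
  then show "f + g \<in> symm_forms scale"
    by (simp add: symm_forms_def Vector_Spaces.linear_iff distrib_left)
next
  fix c f assume "f \<in> symm_forms scale"
  then show "form_scale c f \<in> symm_forms scale"
    by (simp add: symm_forms_def Vector_Spaces.linear_iff form_scale_def distrib_left mult.left_commute)
qed

lemma dim_form_rad_le: "f \<in> symm_forms scale \<Longrightarrow> dim (form_rad f) \<le> dim UNIV"
proof -
  assume f: "f \<in> symm_forms scale"
  have "card (form_rad f) \<le> CARD('v)" by (intro card_mono) auto
  then have "CARD('a) ^ dim (form_rad f) \<le> CARD('a) ^ dim (UNIV :: 'v set)"
    by (simp only: card_subspace[OF subspace_form_rad[OF f]] card_subspace[OF subspace_UNIV])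
  then show ?thesis using card_field_ge_2 by (simp add: power_le_imp_le_exp)
qed

lemma card_form_rad:
  assumes "f \<in> symm_forms scale" "form_rank scale f = r"
  shows "CARD('a) ^ r * card (form_rad f) = CARD('a) ^ dim UNIV"
proof -
  have "r + dim (form_rad f) = dim UNIV"
    using dim_form_rad_le[OF assms(1)] assms(2) by (simp add: form_rank_def)
  then show ?thesis
    by (simp only: card_subspace[OF subspace_form_rad[OF assms(1)]] power_add[symmetric])
qed

text \<open>
  Double counting of the pairs \<open>(f, u)\<close> with \<open>f u u = 0\<close>. A non-zero \<open>f\<close> contributes one \<open>q\<close>-th of all
  vectors. A vector \<open>u\<close> contributes one \<open>q\<close>-th of \<open>N\<close>, as the kernel of a non-zero functional, unless
  it is isotropic for all of \<open>N\<close>.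
\<close>

lemma card_common_isotropic:
  assumes two: "(2::'a) \<noteq> 0" and "odd r"
    and N: "N \<subseteq> symm_forms scale" "form.subspace N"
    and rank: "\<And>f. f \<in> N \<Longrightarrow> f \<noteq> 0 \<Longrightarrow> form_rank scale f = r"
  shows "card {u. \<forall>f\<in>N. f u u = 0} * card N = CARD('a) ^ dim UNIV"
proof -
  let ?q = "CARD('a)" and ?Z = "{u. \<forall>f\<in>N. f u u = 0}" and ?P = "CARD('a) ^ dim UNIV"
  have cardV: "CARD('v) = ?P" using card_subspace[OF subspace_UNIV] .
  have forms: "?q * card {u. f u u = 0} = (if f = 0 then ?q * ?P else ?P)" if f: "f \<in> N" for f
  proof (cases "f = 0")
    case False
    let ?n = "dim (UNIV :: 'v set)" and ?k = "dim (form_rad f)"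
    have symm: "f \<in> symm_forms scale" using f N by auto
    have "r = ?n - ?k" using rank[OF f False] by (simp add: form_rank_def)
    then have "even ?n \<noteq> even ?k" using \<open>odd r\<close> by auto
    moreover have "card {x \<in> UNIV. \<forall>y\<in>UNIV. f x y = 0} = ?q ^ ?k"
      using card_subspace[OF subspace_form_rad[OF symm]] by (simp add: form_rad_def)
    ultimately have "?q * card {x \<in> UNIV. f x x = 0} = ?q ^ ?n"
      using card_isotropic_odd_rank[OF symm two subspace_UNIV] cardV by blast
    then show ?thesis using False by simp
  qed (simp add: cardV)
  have vectors: "?q * card {f \<in> N. f u u = 0} = (if u \<in> ?Z then ?q * card N else card N)" for u
  proof (cases "u \<in> ?Z")
    case True
    then have "{f \<in> N. f u u = 0} = N" by auto
    with True show ?thesis by simp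
  next
    case False
    then obtain f where f: "f \<in> N" "f u u \<noteq> 0" by auto
    have "(\<lambda>f. f u u) ` N = UNIV"
    proof (intro equalityI subsetI)
      fix c :: 'a
      have "form_scale (c / f u u) f \<in> N" using f N by (intro form.subspace_scale)
      then show "c \<in> (\<lambda>f. f u u) ` N"
        using f by (intro image_eqI) (auto simp: form_scale_def)
    qed auto
    then show ?thesis
      unfolding if_not_P[OF False] using form.card_kernel[OF N(2), of "\<lambda>f. f u u"] by simp
  qed
  have "(\<Sum>f\<in>N. card {u. f u u = 0}) = (\<Sum>u\<in>UNIV. card {f \<in> N. f u u = 0})"
    using sum_multicount_gen[of UNIV N "\<lambda>u f. f u u = 0" "\<lambda>f. card {u. f u u = 0}"] by simp
  then have "(\<Sum>f\<in>N. ?q * card {u. f u u = 0}) = (\<Sum>u\<in>UNIV. ?q * card {f \<in> N. f u u = 0})"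
    by (simp only: sum_distrib_left[symmetric])
  moreover have "(\<Sum>f\<in>N. ?q * card {u. f u u = 0}) + ?P = ?q * ?P + card N * ?P"
  proof -
    have zero: "0 \<in> N" by (rule form.subspace_0[OF N(2)])
    have "(\<Sum>f\<in>N. ?q * card {u. f u u = 0}) = (\<Sum>f\<in>N. if f = 0 then ?q * ?P else ?P)"
      by (intro sum.cong refl forms)
    also have "\<dots> = ?q * ?P + (\<Sum>f\<in>N - {0}. ?P)"
      using zero by (subst sum.remove[of _ 0]) (auto intro!: sum.cong)
    also have "\<dots> + ?P = ?q * ?P + card N * ?P"
      using form.card_subspace_pos[OF N(2)] zero
      by (cases "card N") (simp_all add: card_Diff_singleton)
    finally show ?thesis .
  qed
  moreover have "(\<Sum>u\<in>UNIV. ?q * card {f \<in> N. f u u = 0}) + card ?Z * card N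
      = card ?Z * (?q * card N) + ?P * card N"
  proof -
    have "(\<Sum>u\<in>UNIV. ?q * card {f \<in> N. f u u = 0})
        = (\<Sum>u\<in>UNIV. if u \<in> ?Z then ?q * card N else card N)"
      by (simp only: vectors)
    also have "\<dots> = card ?Z * (?q * card N) + card (- ?Z) * card N"
      by (simp only: sum.If_cases[OF finite_space] sum_constant Int_UNIV_left Collect_mem_eq
          Collect_neg_eq of_nat_id)
    finally have "(\<Sum>u\<in>UNIV. ?q * card {f \<in> N. f u u = 0}) + card ?Z * card N
        = card ?Z * (?q * card N) + (card (- ?Z) + card ?Z) * card N"
      by (simp add: algebra_simps)
    also have "card (- ?Z) + card ?Z = ?P"
      using card_Un_disjoint[of "- ?Z" ?Z] cardV by (simp del: Collect_ball_eq add: Un_commute)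
    finally show ?thesis .
  qed
  ultimately have "?q * ?P + card N * ?P + card ?Z * card N
      = card ?Z * (?q * card N) + ?P * card N + ?P"
    by linarith
  then have "?q * ?P + card ?Z * card N = ?q * (card ?Z * card N) + ?P"
    by (simp add: algebra_simps)
  then have "(int ?q - 1) * (int ?P - int (card ?Z * card N)) = 0"
    unfolding of_nat_eq_iff[where 'a = int, symmetric] by (simp add: algebra_simps)
  then have "int ?P = int (card ?Z * card N)" using card_field_ge_2 by auto
  then show ?thesis by (simp only: of_nat_eq_iff)
qed

text \<open>
  Suppose that \<open>g x x \<noteq> 0\<close>. The hyperplane orthogonal to \<open>x\<close> under \<open>g\<close> contains a complement \<open>C\<close> of
  the radical of \<open>f\<close>; it has dimension \<open>r\<close> and \<open>f\<close> is nondegenerate on it. For each scalar \<open>s\<close> the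
  radical of \<open>s f + g\<close>, of dimension at least \<open>n - r\<close>, meets the \<open>(r + 1)\<close>-dimensional space
  \<open>C + \<langle>x\<rangle>\<close> in a non-zero vector \<open>v s\<close>, which turns out to lie in \<open>C\<close>. The \<open>v s\<close> are eigenvectors,
  with the distinct eigenvalues \<open>- s\<close>, of the pair \<open>(g, f)\<close> on \<open>C\<close>. Therefore they are independent,
  and there are \<open>q > r\<close> of them.
\<close>

lemma pencil_isotropic_on_radical:
  assumes f: "f \<in> symm_forms scale" and g: "g \<in> symm_forms scale"
    and rank_f: "form_rank scale f = r" and q: "r < CARD('a)"
    and rank_pencil: "\<And>s. form_rank scale (form_scale s f + g) \<le> r"
    and x: "x \<in> form_rad f"
  shows "g x x = 0"
proof (rule ccontr)
  let ?q = "CARD('a)" and ?n = "dim (UNIV :: 'v set)" and ?R = "form_rad f"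
  assume gx: "g x x \<noteq> 0"
  have R: "subspace ?R" by (rule subspace_form_rad[OF f])
  obtain C where C: "subspace C" "C \<subseteq> {v. g x v = 0}" "C \<inter> ?R = {0}" "{v. g x v = 0} \<subseteq> C + ?R"
    using complement_within[OF R subspace_orthogonal[OF g]] by metis
  \<comment> \<open>the hyperplane and the radical together span everything, because \<open>x\<close> is in the radical and not
    in the hyperplane\<close>
  have "C + ?R = UNIV"
  proof (intro equalityI subsetI UNIV_I)
    fix v
    let ?t = "g x v / g x x"
    have "v - ?t *s x \<in> {v. g x v = 0}" using gx by (simp add: form_simps[OF g])
    then obtain c y where "c \<in> C" "y \<in> ?R" "v - ?t *s x = c + y"
      using C(4) by (auto simp: set_plus_def)
    moreover have "y + ?t *s x \<in> ?R" using R x \<open>y \<in> ?R\<close> by (intro subspace_add subspace_scale)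
    ultimately show "v \<in> C + ?R"
      using set_plus_intro[of c C "y + ?t *s x" ?R] by (simp add: algebra_simps)
  qed
  then have "card C * card ?R = ?q ^ ?n"
    using card_set_plus[OF C(1) R C(3)] card_subspace[OF subspace_UNIV] by simp
  also have "\<dots> = ?q ^ r * card ?R" using card_form_rad[OF f rank_f] by simp
  finally have cardC: "card C = ?q ^ r" using card_subspace_pos[OF R] by (auto simp: card_gt_0_iff)
  let ?D = "C + span {x}"
  have "C \<inter> span {x} = {0}"
  proof -
    have "C \<inter> span {x} \<subseteq> {0}" using C(2) gx by (auto simp: span_line form_simps[OF g])
    then show ?thesis using subspace_0[OF C(1)] span_zero by blast
  qed
  moreover have "x \<noteq> 0" using gx form_zero_left[OF g] by auto
  ultimately have cardD: "card ?D = ?q ^ r * ?q"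
    using card_set_plus[OF C(1) subspace_span] by (simp add: card_line cardC)
  have "\<exists>v. v \<noteq> 0 \<and> v \<in> C \<and> (\<forall>y. g v y = - (s * f v y))" for s
  proof -
    let ?h = "form_scale s f + g"
    have h: "?h \<in> symm_forms scale"
      using f g subspace_symm_forms by (intro form.subspace_add form.subspace_scale)
    have "?n \<le> r + dim (form_rad ?h)" using rank_pencil[of s] by (simp add: form_rank_def)
    then have "?q ^ ?n \<le> ?q ^ r * card (form_rad ?h)"
      using card_field_ge_2 by (simp add: card_subspace subspace_form_rad[OF h] power_add[symmetric] power_increasing)
    also have "\<dots> < ?q ^ r * card (form_rad ?h) * ?q"
      using card_field_ge_2 card_subspace_pos[OF subspace_form_rad[OF h]] by simp
    finally have "CARD('v) < card (form_rad ?h) * card ?D"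
      by (simp add: cardD card_subspace mult.commute mult.left_commute)
    then obtain v where v: "v \<noteq> 0" "v \<in> form_rad ?h" "v \<in> ?D"
      using subspaces_meet_of_card[OF subspace_form_rad[OF h] subspace_set_plus[OF C(1) subspace_span]]
      by blast
    have h0: "s * f v y + g v y = 0" for y using v(2) by (auto simp: form_rad_def form_scale_def)
    \<comment> \<open>evaluating at \<open>x\<close>, which \<open>f\<close> kills, shows that \<open>v\<close> has no component along \<open>x\<close>\<close>
    have "g x v = 0" using h0[of x] x form_sym[OF f, of v x] form_sym[OF g, of v x]
      by (simp add: form_rad_def)
    moreover obtain c t where ct: "c \<in> C" "v = c + t *s x"
      using v(3) by (auto simp: set_plus_def span_line)
    moreover have "g x c = 0" using C(2) ct by auto
    ultimately have "t = 0" using gx by (simp add: form_simps[OF g])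
    then have "v \<in> C" using ct by simp
    moreover have "g v y = - (s * f v y)" for y using h0[of y] by (simp add: eq_neg_iff_add_eq_0 add.commute)
    ultimately show ?thesis using v(1) by blast
  qed
  then obtain v where v: "\<And>s. v s \<noteq> 0" "\<And>s. v s \<in> C" "\<And>s y. g (v s) y = - (s * f (v s) y)"
    by metis
  \<comment> \<open>independence of eigenvectors for distinct eigenvalues\<close>
  have indep: "c s = 0" if "finite A" "(\<Sum>s\<in>A. c s *s v s) = 0" "s \<in> A" for A c s
    using that
  proof (induction A arbitrary: c s rule: finite_induct)
    case (insert a A)
    let ?w = "\<Sum>s\<in>insert a A. (c s * s) *s v s"
    have "f ?w y = - g (\<Sum>s\<in>insert a A. c s *s v s) y" for y
      unfolding form_sum_left[OF f] form_sum_left[OF g]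
      by (simp only: form_simps[OF f] form_simps[OF g] v(3) sum_negf[symmetric] mult.assoc mult_minus_right minus_minus)
    then have "?w \<in> ?R" using insert.prems(1) form_zero_left[OF g] by (simp add: form_rad_def)
    moreover have "?w \<in> C" using C(1) v(2) by (intro subspace_sum subspace_scale)
    ultimately have "?w = 0" using C(3) by blast
    then have "?w - a *s (\<Sum>s\<in>insert a A. c s *s v s) = 0" using insert.prems(1) by simp
    then have "(\<Sum>s\<in>insert a A. (c s * (s - a)) *s v s) = 0"
      by (simp only: scale_sum_right sum_subtractf[symmetric] scale_scale scale_left_diff_distrib[symmetric])
        (simp add: algebra_simps)
    then have "(\<Sum>s\<in>A. (c s * (s - a)) *s v s) = 0" using insert.hyps by simp
    from insert.IH[OF this] have A: "c s = 0" if "s \<in> A" for s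
      using that insert.hyps by force
    then have "c a *s v a = 0" using insert.prems(1) insert.hyps by simp
    then show ?case using A insert.prems(2) v(1) by auto
  qed simp
  \<comment> \<open>so the \<open>q ^ q\<close> linear combinations of the \<open>v s\<close> are distinct elements of \<open>C\<close>\<close>
  have "inj (\<lambda>c :: 'a \<Rightarrow> 'a. \<Sum>s\<in>UNIV. c s *s v s)"
  proof (rule injI)
    fix c d :: "'a \<Rightarrow> 'a"
    assume "(\<Sum>s\<in>UNIV. c s *s v s) = (\<Sum>s\<in>UNIV. d s *s v s)"
    then have "(\<Sum>s\<in>UNIV. (c s - d s) *s v s) = 0"
      by (simp add: scale_left_diff_distrib sum_subtractf)
    from indep[OF _ this] show "c = d" by auto
  qed
  moreover have "range (\<lambda>c :: 'a \<Rightarrow> 'a. \<Sum>s\<in>UNIV. c s *s v s) \<subseteq> C"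
    using C(1) v(2) by (auto intro!: subspace_sum subspace_scale)
  ultimately have "CARD('a \<Rightarrow> 'a) \<le> card C" by (intro card_inj_on_le) auto
  then have "?q ^ ?q \<le> ?q ^ r" by (simp add: card_fun cardC)
  then show False using q card_field_ge_2 by (simp add: power_le_imp_le_exp)
qed

lemma form_rank_zero: "form_rank scale 0 = 0"
proof -
  have "form_rad (0 :: 'v \<Rightarrow> 'v \<Rightarrow> 'a) = UNIV" by (auto simp: form_rad_def)
  then show ?thesis by (simp add: form_rank_def)
qed

text \<open>
  The radical of a non-zero \<open>f\<close> in \<open>N\<close> has \<open>q\<^sup>n / q\<^sup>r\<close> elements and lies in the set of common
  isotropic vectors, which has \<open>q\<^sup>n / card N \<le> q\<^sup>n / q\<^sup>r\<close> elements.
\<close>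

lemma large_constant_rank_subspace:
  assumes two: "(2::'a) \<noteq> 0" and r: "odd r" "r < CARD('a)"
    and N: "N \<subseteq> symm_forms scale" "form.subspace N"
    and rank: "\<And>f. f \<in> N \<Longrightarrow> f \<noteq> 0 \<Longrightarrow> form_rank scale f = r"
    and large: "CARD('a) ^ r \<le> card N"
  shows "card N = CARD('a) ^ r"
    and "\<And>f. f \<in> N \<Longrightarrow> f \<noteq> 0 \<Longrightarrow> form_rad f = {u. \<forall>f\<in>N. f u u = 0}"
proof -
  let ?q = "CARD('a)" and ?Z = "{u. \<forall>f\<in>N. f u u = 0}"
  have rad: "form_rad f \<subseteq> ?Z" if f: "f \<in> N" "f \<noteq> 0" for f
  proof (intro subsetI CollectI ballI)
    fix x g assume x: "x \<in> form_rad f" and g: "g \<in> N"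
    show "g x x = 0"
    proof (rule pencil_isotropic_on_radical[of f g r x, OF _ _ rank[OF f] r(2) _ x])
      fix s
      have "form_scale s f + g \<in> N" using f g N(2)
        by (intro form.subspace_add form.subspace_scale)
      then show "form_rank scale (form_scale s f + g) \<le> r"
        using rank by (cases "form_scale s f + g = 0") (auto simp: form_rank_zero)
    qed (use f g N in auto)
  qed
  have Z: "card ?Z * card N = ?q ^ dim UNIV"
    by (rule card_common_isotropic[OF two r(1) N rank])
  have eq: "card N = ?q ^ r \<and> form_rad f = ?Z" if f: "f \<in> N" "f \<noteq> 0" for f
  proof -
    have symm: "f \<in> symm_forms scale" using f N by auto
    have le: "card (form_rad f) \<le> card ?Z" by (intro card_mono rad[OF f]) simp
    have pos: "card (form_rad f) > 0" by (rule card_subspace_pos[OF subspace_form_rad[OF symm]])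
    have prod: "?q ^ r * card (form_rad f) = card N * card ?Z"
      using card_form_rad[OF symm rank[OF f]] Z by (simp add: mult.commute)
    have "card N * card (form_rad f) \<le> ?q ^ r * card (form_rad f)"
      using le by (simp add: prod)
    then have N': "card N = ?q ^ r" using pos large by simp
    then have "card (form_rad f) = card ?Z" using prod card_field_ge_2 by simp
    then show ?thesis using N' rad[OF f] by (simp add: card_subset_eq)
  qed
  then show "\<And>f. f \<in> N \<Longrightarrow> f \<noteq> 0 \<Longrightarrow> form_rad f = ?Z" by blast
  have "?q ^ 1 \<le> ?q ^ r" using r(1) card_field_ge_2 by (intro power_increasing) (auto elim: oddE)
  then have "card N > 1" using large card_field_ge_2 by simp
  have "N \<noteq> {0}" using \<open>card N > 1\<close> by auto
  then obtain f where "f \<in> N" "f \<noteq> 0" using form.subspace_0[OF N(2)] by blast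
  then show "card N = ?q ^ r" using eq by blast
qed

lemma subspace_forms_at: "form.subspace M \<Longrightarrow> form.subspace (forms_at M u)"
  unfolding form.subspace_def by (auto simp: forms_at_def form_rad_def form_scale_def)

text \<open>The forms of \<open>M\<close> whose radical contains \<open>u\<close> are the kernel of \<open>f \<mapsto> f u\<close>, which maps \<open>M\<close> to the
  dual space.\<close>

lemma card_le_card_forms_at:
  assumes M: "M \<subseteq> symm_forms scale" "form.subspace M"
  shows "card M \<le> CARD('a) ^ dim UNIV * card (forms_at M u)"
proof -
  have "forms_at M u = {f \<in> M. f u = 0}" by (auto simp: forms_at_def form_rad_def fun_eq_iff)
  then have "card M = card ((\<lambda>f. f u) ` M) * card (forms_at M u)"
    using form.card_kernel[OF M(2), of "\<lambda>f. f u"] by simp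
  also have "card ((\<lambda>f. f u) ` M) \<le> card {\<phi>. Vector_Spaces.linear scale (*) \<phi>}"
    using M(1) by (intro card_mono finite_subset[OF subset_UNIV finite_maps])
      (auto simp: symm_forms_def)
  also note card_linear_functionals
  finally show ?thesis by simp
qed

end

section \<open>Spaces of dimension $3r$ with ranks $r$ and $2r$\<close>

locale two_rank_space = finite_form_space scale
  for scale :: "'a::{field,finite} \<Rightarrow> 'v::ab_group_add \<Rightarrow> 'v" (infixr \<open>*s\<close> 75) +
  fixes M :: "('v \<Rightarrow> 'v \<Rightarrow> 'a) set" and r :: nat
  assumes odd_r: "odd r" and odd_field: "odd CARD('a)" and large_field: "r + 1 \<le> CARD('a)"
    and dim_space: "dim (UNIV :: 'v set) = 2 * r"
    and M_symm: "M \<subseteq> symm_forms scale" and M_subspace: "form.subspace M"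
    and dim_M: "form.dim M = 3 * r"
    and ranks: "\<And>f. f \<in> M \<Longrightarrow> f \<noteq> 0 \<Longrightarrow> form_rank scale f = r \<or> form_rank scale f = 2 * r"
begin

text \<open>For \<open>u \<noteq> 0\<close> this is the common radical of all non-zero forms in \<open>forms_at M u\<close>, see
  \<open>form_rad_forms_at\<close> below. Describing it by isotropic vectors makes it a function of
  \<open>forms_at M u\<close> that requires no choice of a form.\<close>

definition radical_at :: "'v \<Rightarrow> 'v set" where
  "radical_at u = {x. \<forall>f\<in>forms_at M u. f x x = 0}"

lemma r_pos: "r > 0"
  using odd_r by (auto elim: oddE)

lemma card_power_gt_1: "CARD('a) ^ r > 1"
  using r_pos card_field_ge_2 by (intro one_less_power) auto

lemma card_space: "CARD('v) = CARD('a) ^ r * CARD('a) ^ r"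
  using card_subspace[OF subspace_UNIV] dim_space by (simp add: mult_2 power_add)

lemma forms_at_symm: "f \<in> forms_at M u \<Longrightarrow> f \<in> symm_forms scale"
  using M_symm by (auto simp: forms_at_def)

lemma forms_at_subspace: "form.subspace (forms_at M u)"
  by (rule subspace_forms_at[OF M_subspace])

text \<open>The non-zero vector \<open>u\<close> in the radical excludes the rank \<open>2 * r\<close>.\<close>

lemma rank_forms_at:
  assumes "u \<noteq> 0" "f \<in> forms_at M u" "f \<noteq> 0"
  shows "form_rank scale f = r"
proof (rule ccontr)
  assume "form_rank scale f \<noteq> r"
  then have "form_rank scale f = 2 * r" using ranks assms by (auto simp: forms_at_def)
  from card_form_rad[OF forms_at_symm[OF assms(2)] this] have "card (form_rad f) = 1"
    using dim_space card_field_ge_2 by simp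
  then obtain y where "form_rad f = {y}" by (auto simp: card_1_singleton_iff)
  moreover have "0 \<in> form_rad f"
    by (rule subspace_0[OF subspace_form_rad[OF forms_at_symm[OF assms(2)]]])
  ultimately show False using assms by (auto simp: forms_at_def)
qed

lemma card_forms_at_ge: "CARD('a) ^ r \<le> card (forms_at M u)"
proof -
  have "CARD('a) ^ (2 * r) * CARD('a) ^ r \<le> CARD('a) ^ (2 * r) * card (forms_at M u)"
    using card_le_card_forms_at[OF M_symm M_subspace, of u] form.card_subspace[OF M_subspace]
    by (simp add: dim_space dim_M power_add[symmetric])
  then show ?thesis using card_field_ge_2 by simp
qed

lemma two_neq_zero: "(2::'a) \<noteq> 0"
  by (rule odd_card_imp_two_neq_zero[OF odd_field])

text \<open>\<open>forms_at M u\<close> attains the largest cardinality possible for a space of constant rank \<open>r\<close>, and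
  this makes all its radicals coincide.\<close>

lemma
  assumes "u \<noteq> 0"
  shows card_forms_at: "card (forms_at M u) = CARD('a) ^ r"
    and form_rad_forms_at: "f \<in> forms_at M u \<Longrightarrow> f \<noteq> 0 \<Longrightarrow> form_rad f = radical_at u"
  unfolding radical_at_def
  using large_constant_rank_subspace[OF two_neq_zero odd_r _ _ forms_at_subspace
      rank_forms_at[OF assms] card_forms_at_ge] forms_at_symm large_field
  by (auto simp: subset_iff)

lemma nonzero_form_at:
  assumes "u \<noteq> 0"
  obtains f where "f \<in> forms_at M u" "f \<noteq> 0"
proof -
  have "forms_at M u \<noteq> {0}" using card_forms_at[OF assms] card_power_gt_1 by auto
  then show ?thesis using form.subspace_0[OF forms_at_subspace] that by blast
qed

lemma
  assumes "u \<noteq> 0"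
  shows subspace_radical_at: "subspace (radical_at u)"
    and card_radical_at: "card (radical_at u) = CARD('a) ^ r"
    and in_radical_at: "u \<in> radical_at u"
proof -
  obtain f where f: "f \<in> forms_at M u" "f \<noteq> 0" using nonzero_form_at[OF assms] .
  note rad = form_rad_forms_at[OF assms f, symmetric] and symm = forms_at_symm[OF f(1)]
  show "subspace (radical_at u)" unfolding rad by (rule subspace_form_rad[OF symm])
  show "card (radical_at u) = CARD('a) ^ r"
    using card_form_rad[OF symm rank_forms_at[OF assms f]] card_field_ge_2
    by (simp add: rad dim_space mult_2 power_add)
  show "u \<in> radical_at u" unfolding rad using f by (simp add: forms_at_def)
qed

text \<open>All of \<open>forms_at M u\<close> has \<open>w\<close> in its radical, and the two spaces have equal cardinality.\<close>

lemma forms_at_eqI: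
  assumes "u \<noteq> 0" "w \<noteq> 0" "w \<in> radical_at u"
  shows "forms_at M u = forms_at M w"
proof (rule card_subset_eq)
  show "forms_at M u \<subseteq> forms_at M w"
  proof
    fix f assume f: "f \<in> forms_at M u"
    show "f \<in> forms_at M w"
    proof (cases "f = 0")
      case True
      then show ?thesis using form.subspace_0[OF forms_at_subspace] by simp
    next
      case False
      then show ?thesis
        using f assms(3) form_rad_forms_at[OF assms(1) f False] by (simp add: forms_at_def)
    qed
  qed
qed (use assms in \<open>simp_all add: card_forms_at\<close>)

lemma radical_at_cong: "forms_at M u = forms_at M w \<Longrightarrow> radical_at u = radical_at w"
  by (simp add: radical_at_def)

lemma radicals_disjoint:
  assumes "u \<noteq> 0" "w \<noteq> 0" "forms_at M u \<noteq> forms_at M w"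
  shows "radical_at u \<inter> radical_at w = {0}"
proof -
  have "x = 0" if "x \<in> radical_at u" "x \<in> radical_at w" for x
    using forms_at_eqI[of u x] forms_at_eqI[of w x] that assms by metis
  then show ?thesis
    using subspace_0[OF subspace_radical_at] assms by blast
qed

lemma forms_at_disjoint:
  assumes "u \<noteq> 0" "w \<noteq> 0" "forms_at M u \<noteq> forms_at M w"
  shows "forms_at M u \<inter> forms_at M w = {0}"
proof -
  have "f = 0" if "f \<in> forms_at M u" "f \<in> forms_at M w" for f
  proof (rule ccontr)
    assume "f \<noteq> 0"
    then have "w \<in> radical_at u"
      using that form_rad_forms_at[OF assms(1) that(1)] by (auto simp: forms_at_def)
    then show False using forms_at_eqI[OF assms(1,2)] assms(3) by blast
  qed
  then show ?thesis using form.subspace_0[OF forms_at_subspace] by blast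
qed

lemma radicals_eq:
  "{form_rad f | f u. u \<noteq> 0 \<and> f \<in> forms_at M u \<and> f \<noteq> 0} = radical_at ` (UNIV - {0})"
proof (intro equalityI subsetI)
  fix A assume "A \<in> radical_at ` (UNIV - {0})"
  then obtain u where u: "u \<noteq> 0" "A = radical_at u" by auto
  obtain f where "f \<in> forms_at M u" "f \<noteq> 0" using nonzero_form_at[OF u(1)] .
  then show "A \<in> {form_rad f | f u. u \<noteq> 0 \<and> f \<in> forms_at M u \<and> f \<noteq> 0}"
    using u form_rad_forms_at[OF u(1)] by blast
qed (auto simp: form_rad_forms_at)

lemma spread: "is_spread scale r (radical_at ` (UNIV - {0}))"
proof -
  have "x \<in> \<Union> (radical_at ` (UNIV - {0}))" for x
  proof (cases "x = 0")
    case True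
    have "(UNIV :: 'v set) \<noteq> {0}"
    proof
      assume "(UNIV :: 'v set) = {0}"
      then have "CARD('v) = card {0 :: 'v}" by (simp only:)
      then show False using card_space r_pos card_field_ge_2 by simp
    qed
    then obtain u :: 'v where "u \<noteq> 0" by auto
    with True show ?thesis using subspace_0[OF subspace_radical_at] by blast
  qed (use in_radical_at in blast)
  moreover have "radical_at u = radical_at w \<or> radical_at u \<inter> radical_at w = {0}"
    if "u \<noteq> 0" "w \<noteq> 0" for u w
    using radicals_disjoint[OF that] radical_at_cong by blast
  ultimately show ?thesis
    unfolding is_spread_def
    by (auto simp: subspace_radical_at dim_eq_iff_card card_radical_at)
qed

text \<open>The non-zero vectors, \<open>q\<^bsup>2 r\<^esup> - 1\<close> in number, are partitioned into the sets of \<open>q\<^sup>r - 1\<close>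
  non-zero vectors of the members of the spread.\<close>

lemma card_spread: "card (radical_at ` (UNIV - {0})) = CARD('a) ^ r + 1"
proof -
  let ?S = "radical_at ` (UNIV - {0})" and ?Q = "CARD('a) ^ r"
  have "(UNIV :: 'v set) - {0} = (\<Union>A\<in>?S. A - {0})"
    using in_radical_at by auto
  moreover have "card (\<Union>A\<in>?S. A - {0}) = (\<Sum>A\<in>?S. card (A - {0}))"
  proof (rule card_UN_disjoint)
    have "(radical_at u - {0}) \<inter> (radical_at w - {0}) = {}"
      if "u \<noteq> 0" "w \<noteq> 0" "radical_at u \<noteq> radical_at w" for u w
      using radicals_disjoint[OF that(1,2)] radical_at_cong[of u w] that(3) by blast
    then show "\<forall>A\<in>?S. \<forall>B\<in>?S. A \<noteq> B \<longrightarrow> (A - {0}) \<inter> (B - {0}) = {}" by auto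
  qed auto
  moreover have "card (A - {0}) = ?Q - 1" if A: "A \<in> ?S" for A
  proof -
    obtain u where u: "u \<noteq> 0" "A = radical_at u" using A by auto
    then have "0 \<in> A" using subspace_0[OF subspace_radical_at] by simp
    then show ?thesis using u by (simp add: card_Diff_singleton card_radical_at)
  qed
  ultimately have "CARD('v) - 1 = card ?S * (?Q - 1)" by (simp add: card_Diff_singleton)
  moreover have "CARD('v) - 1 = (?Q + 1) * (?Q - 1)"
    using card_space by (simp add: algebra_simps)
  ultimately have "card ?S * (?Q - 1) = (?Q + 1) * (?Q - 1)" by (simp only:)
  moreover have "?Q - 1 \<noteq> 0" using card_power_gt_1 by simp
  ultimately show ?thesis by (simp only: mult_cancel2) blast
qed

lemma card_forms_at_family: "card {forms_at M u | u. u \<noteq> 0} = CARD('a) ^ r + 1"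
proof -
  let ?rad = "\<lambda>N. {x. \<forall>f\<in>N. (f :: 'v \<Rightarrow> 'v \<Rightarrow> 'a) x x = 0}"
  have "inj_on ?rad {forms_at M u | u. u \<noteq> 0}"
  proof (rule inj_onI, clarify)
    fix u w assume *: "u \<noteq> 0" "w \<noteq> 0" "?rad (forms_at M u) = ?rad (forms_at M w)"
    then have "w \<in> radical_at u" using in_radical_at[of w] by (simp add: radical_at_def)
    then show "forms_at M u = forms_at M w" using * by (intro forms_at_eqI)
  qed
  moreover have "?rad ` {forms_at M u | u. u \<noteq> 0} = radical_at ` (UNIV - {0})"
    by (auto simp: radical_at_def image_iff)
  ultimately show ?thesis using card_image[of ?rad "{forms_at M u | u. u \<noteq> 0}"] card_spread by simp
qed

text \<open>Such an \<open>N\<close> also attains the largest possible cardinality, so its forms share one radical. For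
  any non-zero \<open>u\<close> in it, \<open>N\<close> is contained in \<open>forms_at M u\<close>, which is no larger.\<close>

lemma constant_rank_subspace_is_forms_at:
  assumes "N \<subseteq> M" "constant_rank_subspace scale r N" "card N = CARD('a) ^ r"
  shows "\<exists>u. u \<noteq> 0 \<and> N = forms_at M u"
proof -
  let ?Z = "{x. \<forall>f\<in>N. f x x = 0}"
  have N: "form.subspace N" "\<And>f. f \<in> N \<Longrightarrow> f \<noteq> 0 \<Longrightarrow> form_rank scale f = r" "N \<noteq> {0}"
    "N \<subseteq> symm_forms scale"
    using assms(2) by (auto simp: constant_rank_subspace_def)
  have rad: "form_rad f = ?Z" if "f \<in> N" "f \<noteq> 0" for f
    using large_constant_rank_subspace(2)[OF two_neq_zero odd_r _ N(4) N(1) N(2)] that assms(3)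
      large_field by simp
  obtain f where f: "f \<in> N" "f \<noteq> 0" using N(3) form.subspace_0[OF N(1)] by blast
  have symm: "f \<in> symm_forms scale" using f N(4) by auto
  have "card (form_rad f) > 1"
    using card_form_rad[OF symm N(2)[OF f]] dim_space card_power_gt_1
    by (simp add: mult_2 power_add)
  then have "form_rad f \<noteq> {0}" by auto
  then obtain u where u: "u \<in> form_rad f" "u \<noteq> 0"
    using subspace_0[OF subspace_form_rad[OF symm]] by blast
  have "N \<subseteq> forms_at M u"
  proof
    fix g assume "g \<in> N"
    then show "g \<in> forms_at M u"
      using u rad[OF f] rad[of g] assms(1) form.subspace_0[OF forms_at_subspace]
      by (cases "g = 0") (auto simp: forms_at_def)
  qed
  then have "N = forms_at M u"
    using assms(3) card_forms_at[OF u(2)] by (intro card_subset_eq) auto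
  with u show ?thesis by blast
qed

text \<open>
  The space is the direct sum of the two radicals. For non-zero \<open>f\<close> and \<open>g\<close> from the two summands,
  \<open>f\<close> lives on the radical of \<open>g\<close> and \<open>g\<close> on that of \<open>f\<close>, so \<open>f + g\<close> is an orthogonal sum: a vector
  in its radical is in the radicals of both, hence 0, and the rank is \<open>2 * r\<close>.
\<close>

lemma rank_r_in_sum:
  assumes "u \<noteq> 0" "w \<noteq> 0" "forms_at M u \<noteq> forms_at M w"
    and "h \<in> forms_at M u + forms_at M w" "form_rank scale h = r"
  shows "h \<in> forms_at M u \<or> h \<in> forms_at M w"
proof (rule ccontr)
  assume not: "\<not> ?thesis"
  obtain f g where h: "h = f + g" and f: "f \<in> forms_at M u" and g: "g \<in> forms_at M w"
    using assms(4) by (auto simp: set_plus_def)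
  have nz: "f \<noteq> 0" "g \<noteq> 0" using not h f g by auto
  note symm = forms_at_symm[OF f] forms_at_symm[OF g]
  have rad: "form_rad f = radical_at u" "form_rad g = radical_at w"
    using form_rad_forms_at f g nz assms by auto
  have disj: "radical_at u \<inter> radical_at w = {0}" by (rule radicals_disjoint[OF assms(1-3)])
  have "card (radical_at u + radical_at w) = CARD('v)"
    using card_set_plus[OF subspace_radical_at subspace_radical_at disj] assms
    by (simp add: card_radical_at card_space)
  then have span: "radical_at u + radical_at w = UNIV" by (intro card_subset_eq) auto
  have "x = 0" if "x \<in> form_rad h" for x
  proof -
    have h0: "f x y + g x y = 0" for y using that by (auto simp: form_rad_def h)
    have f0: "f x y = 0" if "y \<in> radical_at u" for y
      using that form_sym[OF symm(1), of x y] unfolding rad[symmetric] by (simp add: form_rad_def)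
    have g0: "g x y = 0" if "y \<in> radical_at w" for y
      using that form_sym[OF symm(2), of x y] unfolding rad[symmetric] by (simp add: form_rad_def)
    have "f x y = 0 \<and> g x y = 0" for y
    proof -
      obtain a b where "y = a + b" "a \<in> radical_at u" "b \<in> radical_at w"
        using span by (metis UNIV_I set_plus_elim)
      then show ?thesis using h0[of a] h0[of b] f0[of a] g0[of b]
        by (simp add: form_simps[OF symm(1)] form_simps[OF symm(2)])
    qed
    then have "x \<in> radical_at u \<inter> radical_at w" unfolding rad[symmetric] by (simp add: form_rad_def)
    then show ?thesis using disj by auto
  qed
  moreover have hs: "h \<in> symm_forms scale"
    unfolding h by (rule form.subspace_add[OF subspace_symm_forms symm])
  ultimately have "form_rad h = {0}" using subspace_0[OF subspace_form_rad[OF hs]] by auto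
  then have "CARD('a) ^ r = CARD('a) ^ (2 * r)"
    using card_form_rad[OF hs assms(5)] dim_space by simp
  then show False using r_pos card_field_ge_2 by simp
qed

lemma card_sum_forms_at:
  assumes "u \<noteq> 0" "w \<noteq> 0" "forms_at M u \<noteq> forms_at M w"
  shows "card (forms_at M u + forms_at M w) = CARD('a) ^ (2 * r)"
  using form.card_set_plus[OF forms_at_subspace forms_at_subspace forms_at_disjoint[OF assms]] assms
  by (simp add: card_forms_at mult_2 power_add)

lemma sum_disjoint_forms_at:
  assumes "u \<noteq> 0" "w \<noteq> 0" "z \<noteq> 0" "forms_at M u \<noteq> forms_at M w"
    "forms_at M z \<noteq> forms_at M u" "forms_at M z \<noteq> forms_at M w"
  shows "(forms_at M u + forms_at M w) \<inter> forms_at M z = {0}"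
proof -
  have "f = 0" if f: "f \<in> forms_at M u + forms_at M w" "f \<in> forms_at M z" for f
  proof (rule ccontr)
    assume "f \<noteq> 0"
    then have "form_rank scale f = r" using rank_forms_at assms f by blast
    then have "f \<in> forms_at M u \<or> f \<in> forms_at M w"
      using rank_r_in_sum assms f by blast
    then show False
      using \<open>f \<noteq> 0\<close> f(2) forms_at_disjoint[OF assms(3,1,5)] forms_at_disjoint[OF assms(3,2,6)]
      by blast
  qed
  moreover have "0 \<in> forms_at M u + forms_at M w"
    by (intro form.subspace_0 form.subspace_set_plus forms_at_subspace)
  ultimately show ?thesis using form.subspace_0[OF forms_at_subspace] by blast
qed

lemma sum_of_three_forms_at:
  assumes "u \<noteq> 0" "w \<noteq> 0" "z \<noteq> 0" "forms_at M u \<noteq> forms_at M w"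
    "forms_at M z \<noteq> forms_at M u" "forms_at M z \<noteq> forms_at M w"
  shows "M = forms_at M u + forms_at M w + forms_at M z"
proof (rule card_subset_eq[symmetric])
  have "forms_at M x \<subseteq> M" for x by (auto simp: forms_at_def)
  then show "forms_at M u + forms_at M w + forms_at M z \<subseteq> M"
    using M_subspace by (auto elim!: set_plus_elim intro!: form.subspace_add)
  have "card (forms_at M u + forms_at M w + forms_at M z) = CARD('a) ^ (2 * r) * CARD('a) ^ r"
    using form.card_set_plus[OF form.subspace_set_plus[OF forms_at_subspace forms_at_subspace]
        forms_at_subspace sum_disjoint_forms_at[OF assms]] assms
    by (simp add: card_sum_forms_at card_forms_at)
  then show "card (forms_at M u + forms_at M w + forms_at M z) = card M"
    using form.card_subspace[OF M_subspace] dim_M by (simp add: power_add[symmetric])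
qed simp

end

section \<open>The spread of radicals and the decomposition of $M$\<close>

theorem theorem13:
  fixes scale :: "'a::{field,finite} \<Rightarrow> 'v::ab_group_add \<Rightarrow> 'v"
    and M :: "('v \<Rightarrow> 'v \<Rightarrow> 'a) set"
    and q r n :: nat
  assumes "odd r" and "n = 2 * r"
    and "card (UNIV :: 'a set) = q" and "odd q" and "q \<ge> r + 1"
    and "vector_space scale" and "vector_space.dim scale (UNIV :: 'v set) = n"
    and "M \<subseteq> symm_forms scale" and "module.subspace form_scale M"
    and "vector_space.dim form_scale M = 3 * r"
    and "\<forall>f\<in>M. f \<noteq> 0 \<longrightarrow> form_rank scale f = r \<or> form_rank scale f = n"
  shows
    "((\<forall>u. u \<noteq> 0 \<longrightarrow>
         (\<exists>U. module.subspace scale U \<and> vector_space.dim scale U = r \<and>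
              (\<forall>f \<in> forms_at M u. f \<noteq> 0 \<longrightarrow> form_rad f = U))) \<and>
      (\<forall>u w. u \<noteq> 0 \<longrightarrow> w \<noteq> 0 \<longrightarrow>
         forms_at M u = forms_at M w \<or> forms_at M u \<inter> forms_at M w = {0}))
     \<and>
     (is_spread scale r {form_rad f | f u. u \<noteq> 0 \<and> f \<in> forms_at M u \<and> f \<noteq> 0} \<and>
      card {form_rad f | f u. u \<noteq> 0 \<and> f \<in> forms_at M u \<and> f \<noteq> 0} = q ^ r + 1 \<and>
      card {forms_at M u | u. u \<noteq> 0} = q ^ r + 1 \<and>
      (\<forall>N. N \<subseteq> M \<longrightarrow> constant_rank_subspace scale r N \<longrightarrow>
           vector_space.dim form_scale N = r \<longrightarrow>
           (\<exists>u. u \<noteq> 0 \<and> N = forms_at M u)))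
     \<and>
     (\<forall>u w. u \<noteq> 0 \<longrightarrow> w \<noteq> 0 \<longrightarrow>
        vector_space.dim form_scale (forms_at M w) = r \<longrightarrow>
        forms_at M w \<noteq> forms_at M u \<longrightarrow>
        forms_at M u \<inter> forms_at M w = {0} \<and>
        vector_space.dim form_scale (forms_at M u + forms_at M w) = n \<and>
        (\<forall>f \<in> forms_at M u + forms_at M w. form_rank scale f = r \<longrightarrow>
           f \<in> forms_at M u \<or> f \<in> forms_at M w) \<and>
        (\<forall>z. z \<noteq> 0 \<longrightarrow>
           constant_rank_subspace scale r (forms_at M z) \<longrightarrow>
           vector_space.dim form_scale (forms_at M z) = r \<longrightarrow>
           forms_at M z \<noteq> forms_at M u \<longrightarrow> forms_at M z \<noteq> forms_at M w \<longrightarrow>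
           (forms_at M u + forms_at M w) \<inter> forms_at M z = {0} \<and>
           M = forms_at M u + forms_at M w + forms_at M z))"
proof -
  interpret V: vector_space scale by fact
  have "r > 0" using \<open>odd r\<close> by (auto elim: oddE)
  have "finite (UNIV :: 'v set)"
  proof -
    obtain B where B: "UNIV \<subseteq> V.span B" "card B = n"
      using V.basis_exists[of UNIV] assms(7) by metis
    have "finite B" using B(2) \<open>r > 0\<close> \<open>n = 2 * r\<close> by (intro card_ge_0_finite) simp
    then have "finite (V.span B)" by (intro V.finite_span) auto
    then show ?thesis using B(1) by (rule finite_subset[rotated])
  qed
  then interpret two_rank_space scale M r
    using assms by unfold_locales auto
  have q: "q = CARD('a)" using assms(3) by simp
  show ?thesis
  proof (intro conjI)
    show "\<forall>u. u \<noteq> 0 \<longrightarrow> (\<exists>U. module.subspace scale U \<and> vector_space.dim scale U = r \<and>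
        (\<forall>f \<in> forms_at M u. f \<noteq> 0 \<longrightarrow> form_rad f = U))"
    proof (intro allI impI exI conjI ballI)
      fix u :: 'v assume u: "u \<noteq> 0"
      show "V.subspace (radical_at u)" by (rule subspace_radical_at[OF u])
      then show "V.dim (radical_at u) = r" using card_radical_at[OF u] by (simp add: dim_eq_iff_card)
    qed (rule form_rad_forms_at)
    show "\<forall>u w. u \<noteq> 0 \<longrightarrow> w \<noteq> 0 \<longrightarrow>
        forms_at M u = forms_at M w \<or> forms_at M u \<inter> forms_at M w = {0}"
      using forms_at_disjoint by blast
    show "is_spread scale r {form_rad f | f u. u \<noteq> 0 \<and> f \<in> forms_at M u \<and> f \<noteq> 0}"
      unfolding radicals_eq by (rule spread)
    show "card {form_rad f | f u. u \<noteq> 0 \<and> f \<in> forms_at M u \<and> f \<noteq> 0} = q ^ r + 1"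
      unfolding radicals_eq q by (rule card_spread)
    show "card {forms_at M u | u. u \<noteq> 0} = q ^ r + 1"
      unfolding q by (rule card_forms_at_family)
    show "\<forall>N. N \<subseteq> M \<longrightarrow> constant_rank_subspace scale r N \<longrightarrow>
        vector_space.dim form_scale N = r \<longrightarrow> (\<exists>u. u \<noteq> 0 \<and> N = forms_at M u)"
    proof (intro allI impI)
      fix N assume N: "N \<subseteq> M" "constant_rank_subspace scale r N" "form.dim N = r"
      then have "card N = CARD('a) ^ r"
        using form.dim_eq_iff_card[of N r] by (simp add: constant_rank_subspace_def)
      with N(1,2) show "\<exists>u. u \<noteq> 0 \<and> N = forms_at M u"
        by (rule constant_rank_subspace_is_forms_at)
    qed
    show "\<forall>u w. u \<noteq> 0 \<longrightarrow> w \<noteq> 0 \<longrightarrow>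
        vector_space.dim form_scale (forms_at M w) = r \<longrightarrow>
        forms_at M w \<noteq> forms_at M u \<longrightarrow>
        forms_at M u \<inter> forms_at M w = {0} \<and>
        vector_space.dim form_scale (forms_at M u + forms_at M w) = n \<and>
        (\<forall>f \<in> forms_at M u + forms_at M w. form_rank scale f = r \<longrightarrow>
           f \<in> forms_at M u \<or> f \<in> forms_at M w) \<and>
        (\<forall>z. z \<noteq> 0 \<longrightarrow>
           constant_rank_subspace scale r (forms_at M z) \<longrightarrow>
           vector_space.dim form_scale (forms_at M z) = r \<longrightarrow>
           forms_at M z \<noteq> forms_at M u \<longrightarrow> forms_at M z \<noteq> forms_at M w \<longrightarrow>
           (forms_at M u + forms_at M w) \<inter> forms_at M z = {0} \<and>
           M = forms_at M u + forms_at M w + forms_at M z)"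
      (is "\<forall>u w. _ \<longrightarrow> _ \<longrightarrow> _ \<longrightarrow> _ \<longrightarrow> ?sum_claims u w")
    proof (intro allI impI)
      fix u w :: 'v assume *: "u \<noteq> 0" "w \<noteq> 0" "forms_at M w \<noteq> forms_at M u"
      note uw = *(1,2) *(3)[symmetric]
      have "form.subspace (forms_at M u + forms_at M w)"
        by (intro form.subspace_set_plus forms_at_subspace)
      then have dim: "form.dim (forms_at M u + forms_at M w) = n"
        using card_sum_forms_at[OF uw] by (simp add: form.dim_eq_iff_card \<open>n = 2 * r\<close>)
      show "?sum_claims u w"
      proof (intro conjI ballI allI impI)
        show "forms_at M u \<inter> forms_at M w = {0}" by (rule forms_at_disjoint[OF uw])
        show "f \<in> forms_at M u \<or> f \<in> forms_at M w"
          if "f \<in> forms_at M u + forms_at M w" "form_rank scale f = r" for f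
          by (rule rank_r_in_sum[OF uw that])
        fix z :: 'v
        assume z: "z \<noteq> 0" "forms_at M z \<noteq> forms_at M u" "forms_at M z \<noteq> forms_at M w"
        show "(forms_at M u + forms_at M w) \<inter> forms_at M z = {0}"
          by (rule sum_disjoint_forms_at[OF uw(1,2) z(1) uw(3) z(2,3)])
        show "M = forms_at M u + forms_at M w + forms_at M z"
          by (rule sum_of_three_forms_at[OF uw(1,2) z(1) uw(3) z(2,3)])
      qed (rule dim)
    qed
  qed
qed

end
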